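(* Let $\mathbf{X}=(\mathbf{x}_1,\dots,\mathbf{x}_n)^\top\in\mathbb{R}^{n\times d}$ satisfy $\|\mathbf{x}_i\|_\infty\le\zeta$ for all $i$, and let $\mathbf{A}=\mathbf{B}\mathbf{C}$ be any factorization with $\mathbf{A},\mathbf{B},\mathbf{C}\in\mathbb{R}^{n\times n}$, where $\mathbf{A}$ is the running-average matrix. Let $\mathbf{b}_t$ be the $t$-th row of $\mathbf{B}$, and let $\mathrm{sens}_{k,b}(\mathbf{C})$ be the $b$-min-separation sensitivity. Let $\widehat{\boldsymbol\mu}_t$ be the private running mean produced by the matrix factorization mechanism and $\boldsymbol\mu_t=\frac1t\sum_{j=1}^t\mathbf{x}_j$. Then for every $t\in\{1,\dots,n\}$ and $\beta\in(0,1)$, with probability at least $1-\beta$, $$\|\widehat{\boldsymbol\mu}_t-\boldsymbol\mu_t\|_2=O\left(\sqrt{d\zeta^2}\;\sigma_{\varepsilon,\delta}\;\mathrm{sens}_{k,b}(\mathbf{C})\,\|\mathbf{b}_t\|_2\left(\sqrt d+\sqrt{\ln\tfrac1\beta}\right)\right),$$ with an absolute implied constant.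
   Context: $\mathbf{A}_{i,j}=1/i$ for $j\le i$ and $0$ for $j>i$. Sensitivity: $\Pi_{k,b}$ is the family of subsets $\pi\subseteq\{1,\dots,n\}$ with $|\pi|\le k$ such that any two distinct $i,j\in\pi$ satisfy $|i-j|\ge b$, and $$\mathrm{sens}_{k,b}(\mathbf{C})=\max_{\pi\in\Pi_{k,b}}\ \max_{(x_i)_{i\in\pi},\ x_i\in\mathbb{R}^d,\ \|x_i\|_2\le1}\Big\|\sum_{i\in\pi}\mathbf{C}_{:,i}\,x_i^\top\Big\|_F .$$ Matrix factorization mechanism: $\widehat{\mathbf{Y}}=\mathbf{B}(\mathbf{C}\mathbf{X}+\mathbf{Z})=\mathbf{A}\mathbf{X}+\mathbf{B}\mathbf{Z}$, where $\mathbf{Z}\in\mathbb{R}^{n\times d}$ has i.i.d. entries $\mathcal N\big(0,\ \sigma_{\varepsilon,\delta}^2\cdot\xi^2\cdot\mathrm{sens}_{k,b}^2(\mathbf{C})\big)$, with $\xi=\sqrt{d\zeta^2}$ the resulting bound on the $\ell_2$-norms of the rows of $\mathbf{X}$, and $\sigma_{\varepsilon,\delta}>0$ the noise multiplier of the Gaussian mechanism (a positive number depending only on the privacy parameters $\varepsilon,\delta$, e.g. $\sigma_{\varepsilon,\delta}=\frac1\varepsilon\sqrt{2\ln(1.25/\delta)}$). $\widehat{\boldsymbol\mu}_t$ is the $t$-th row of $\widehat{\mathbf{Y}}$. *)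

theory Defs
  imports "HOL-Probability.Probability" "Jordan_Normal_Form.Matrix"
begin

unbundle no vec_syntax
hide_const (open) Finite_Cartesian_Product.vec Finite_Cartesian_Product.row
  Finite_Cartesian_Product.mat

text \<open>Rows and columns are indexed from 0: row \<open>t\<close> in 1-based numbering is row \<open>t - 1\<close> here.\<close>

definition l2_norm :: "real vec \<Rightarrow> real" where
  "l2_norm v = L2_set (\<lambda>i. v $ i) {..<dim_vec v}"

text \<open>The inserted 0 only matters for the vector of dimension 0.\<close>

definition linf_norm :: "real vec \<Rightarrow> real" where
  "linf_norm v = Max (insert 0 ((\<lambda>i. \<bar>v $ i\<bar>) ` {..<dim_vec v}))"

definition frobenius_norm :: "real mat \<Rightarrow> real" where
  "frobenius_norm M = L2_set (\<lambda>ij. M $$ ij) ({..<dim_row M} \<times> {..<dim_col M})"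

text \<open>With 0-based indices the entry \<open>1/i\<close> becomes \<open>1/(i + 1)\<close>.\<close>

definition running_average_mat :: "nat \<Rightarrow> real mat" where
  "running_average_mat n = mat n n (\<lambda>(i, j). if j \<le> i then 1 / real (Suc i) else 0)"

definition min_sep_sets :: "nat \<Rightarrow> nat \<Rightarrow> nat \<Rightarrow> nat set set" where
  "min_sep_sets n k b = {\<pi>. \<pi> \<subseteq> {..<n} \<and> card \<pi> \<le> k \<and>
     (\<forall>i\<in>\<pi>. \<forall>j\<in>\<pi>. i \<noteq> j \<longrightarrow> \<bar>int i - int j\<bar> \<ge> int b)}"

text \<open>The matrix \<open>\<Sum>i\<in>\<pi>. C\<^bsub>:,i\<^esub> x\<^sub>i\<^sup>T\<close>, written entrywise because the type of
  matrices of arbitrary size has no sum operator.\<close>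

definition participation_mat :: "real mat \<Rightarrow> nat \<Rightarrow> nat set \<Rightarrow> (nat \<Rightarrow> real vec) \<Rightarrow> real mat" where
  "participation_mat C d \<pi> x =
     mat (dim_row C) d (\<lambda>(r, c). \<Sum>i\<in>\<pi>. col C i $ r * x i $ c)"

text \<open>The inner supremum is a maximum: a continuous function on a nonempty compact set (a finite
  product of closed unit balls).\<close>

definition sens :: "nat \<Rightarrow> nat \<Rightarrow> nat \<Rightarrow> real mat \<Rightarrow> real" where
  "sens d k b C = (MAX \<pi>\<in>min_sep_sets (dim_col C) k b.
     SUP x\<in>{x. \<forall>i\<in>\<pi>. x i \<in> carrier_vec d \<and> l2_norm (x i) \<le> 1}.
       frobenius_norm (participation_mat C d \<pi> x))"

text \<open>Normal distribution with mean \<open>m\<close> and variance \<open>v\<close>; for \<open>v = 0\<close> it is the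
  point mass at \<open>m\<close>, which occurs as noise when the sensitivity or the data bound is 0.\<close>

definition gaussian :: "real \<Rightarrow> real \<Rightarrow> real measure" where
  "gaussian m v = (if v = 0 then return borel m
     else density lborel (\<lambda>x. ennreal (normal_density m (sqrt v) x)))"

text \<open>Joint law of the entries of an \<open>n \<times> d\<close> matrix with i.i.d. centred normal entries of
  variance \<open>v\<close>; the random matrix itself is \<open>mat n d z\<close> for a sample \<open>z\<close>.\<close>

definition gaussian_noise :: "nat \<Rightarrow> nat \<Rightarrow> real \<Rightarrow> (nat \<times> nat \<Rightarrow> real) measure" where
  "gaussian_noise n d v = (\<Pi>\<^sub>M ij\<in>{..<n} \<times> {..<d}. gaussian 0 v)"

text \<open>\<open>\<sigma>\<close> is the noise multiplier of the Gaussian mechanism; \<open>\<xi>\<close> bounds the \<open>\<ell>\<^sub>2\<close>-norm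
  of a data row whose entries are bounded by \<open>\<zeta>\<close>.\<close>

definition mechanism_noise ::
  "nat \<Rightarrow> nat \<Rightarrow> nat \<Rightarrow> nat \<Rightarrow> real mat \<Rightarrow> real \<Rightarrow> real \<Rightarrow> (nat \<times> nat \<Rightarrow> real) measure" where
  "mechanism_noise n d k b C \<zeta> \<sigma> =
     (let \<xi> = sqrt (real d * \<zeta>\<^sup>2) in gaussian_noise n d (\<sigma>\<^sup>2 * \<xi>\<^sup>2 * (sens d k b C)\<^sup>2))"

definition mf_mechanism :: "real mat \<Rightarrow> real mat \<Rightarrow> real mat \<Rightarrow> real mat \<Rightarrow> real mat" where
  "mf_mechanism B C X Z = B * (C * X + Z)"

definition private_running_mean ::
  "real mat \<Rightarrow> real mat \<Rightarrow> real mat \<Rightarrow> real mat \<Rightarrow> nat \<Rightarrow> real vec" where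
  "private_running_mean B C X Z t = row (mf_mechanism B C X Z) (t - 1)"

definition running_mean :: "real mat \<Rightarrow> nat \<Rightarrow> real vec" where
  "running_mean X t = vec (dim_col X) (\<lambda>c. 1 / real t * (\<Sum>j = 1..t. row X (j - 1) $ c))"

end

theory Submission
  imports Defs
begin

text \<open>The error of the mechanism is row \<open>t\<close> of \<open>B Z\<close>, a vector of \<open>d\<close> independent centred
  Gaussians \<open>G\<^sub>c\<close> of standard deviation \<open>s = sqrt v * \<parallel>b\<^sub>t\<parallel>\<close>. Since
  \<open>E exp (G\<^sub>c\<^sup>2 / (4 s\<^sup>2)) = sqrt 2\<close>, independence gives \<open>E exp (\<parallel>G\<parallel>\<^sup>2 / (4 s\<^sup>2)) = sqrt 2 ^ d\<close>,
  and Markov's inequality bounds the tail of \<open>\<parallel>G\<parallel>\<^sup>2\<close> with the constant 2.\<close>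

section \<open>Nonnegativity of the sensitivity and the exact error of the mechanism\<close>

text \<open>The empty participation set is always admissible and contributes 0 to the maximum. The
  sign lets the square root of the noise variance be written with the sensitivity itself instead of
  its absolute value.\<close>

lemma sens_nonneg: "0 \<le> sens d k b C"
proof -
  let ?f = "\<lambda>\<pi>. SUP x\<in>{x. \<forall>i\<in>\<pi>. x i \<in> carrier_vec d \<and> l2_norm (x i) \<le> 1}.
       frobenius_norm (participation_mat C d \<pi> x)"
  have fin: "finite (min_sep_sets (dim_col C) k b)"
    by (rule finite_subset[of _ "Pow {..<dim_col C}"]) (auto simp: min_sep_sets_def)
  have "frobenius_norm (participation_mat C d {} x) = 0" for x
    by (auto simp: frobenius_norm_def participation_mat_def L2_set_def intro!: sum.neutral)
  then have "?f {} = 0"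
    by simp
  moreover have "{} \<in> min_sep_sets (dim_col C) k b"
    by (simp add: min_sep_sets_def)
  then have "?f {} \<le> sens d k b C"
    unfolding sens_def using fin by (intro Max_ge finite_imageI imageI)
  ultimately show ?thesis
    by (simp only:)
qed

text \<open>Expanding \<open>B * (C * X + Z)\<close> leaves the signal \<open>B * C * X\<close>, and
  row \<open>t - 1\<close> of this product is exactly the running mean. It cancels, so the error
  does not depend on the data.\<close>

lemma mf_mechanism_error:
  assumes X: "X \<in> carrier_mat n d" and B: "B \<in> carrier_mat n n" and C: "C \<in> carrier_mat n n"
    and Z: "Z \<in> carrier_mat n d" and A: "running_average_mat n = B * C" and t: "t \<in> {1..n}"
  shows "private_running_mean B C X Z t - running_mean X t = row (B * Z) (t - 1)"
proof -
  have "B * (C * X + Z) = B * (C * X) + B * Z"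
    using X B C Z by (intro mult_add_distrib_mat) auto
  also have "B * (C * X) = running_average_mat n * X"
    unfolding A using X B C by (intro assoc_mult_mat[symmetric]) auto
  finally have eq: "mf_mechanism B C X Z = running_average_mat n * X + B * Z"
    by (simp add: mf_mechanism_def)
  have avg: "(running_average_mat n * X) $$ (t - 1, c) = running_mean X t $ c" if c: "c < d" for c
  proof -
    \<comment> \<open>Since \<open>t\<close> is at least 1, the denominator
      \<open>Suc (t - 1)\<close> is \<open>t\<close>, and the condition \<open>j \<le> t - 1\<close>
      means \<open>j < t\<close>.\<close>
    have "(running_average_mat n * X) $$ (t - 1, c)
        = (\<Sum>j<n. (if j \<le> t - 1 then 1 / real t else 0) * X $$ (j, c))"
      using X t c by (auto simp: running_average_mat_def scalar_prod_def atLeast0LessThan intro!: sum.cong)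
    also have "\<dots> = (\<Sum>j<n. if j \<in> {..<t} then 1 / real t * X $$ (j, c) else 0)"
      using t by (intro sum.cong) auto
    also have "\<dots> = (\<Sum>j\<in>{..<n} \<inter> {..<t}. 1 / real t * X $$ (j, c))"
      by (rule sum.inter_restrict[symmetric]) simp
    also have "{..<n} \<inter> {..<t} = {..<t}"
      using t by auto
    also have "(\<Sum>j<t. 1 / real t * X $$ (j, c)) = 1 / real t * (\<Sum>j<t. X $$ (j, c))"
      by (simp add: sum_distrib_left)
    also have "(\<Sum>j<t. X $$ (j, c)) = (\<Sum>j = 1..t. X $$ (j - 1, c))"
      by (rule sum.reindex_bij_witness[of _ "\<lambda>j. j - 1" Suc]) auto
    also have "\<dots> = (\<Sum>j = 1..t. row X (j - 1) $ c)"
      using X t c by (intro sum.cong) auto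
    finally show ?thesis
      using X c by (simp add: running_mean_def)
  qed
  have dims: "running_average_mat n \<in> carrier_mat n n"
    by (simp add: running_average_mat_def)
  show ?thesis
  proof (rule eq_vecI)
    fix c assume "c < dim_vec (row (B * Z) (t - 1))"
    then have c: "c < d" using Z by simp
    have row: "row (B * Z) (t - 1) $ c = (B * Z) $$ (t - 1, c)"
      using B Z t c by (intro index_row) auto
    have "private_running_mean B C X Z t $ c
        = (running_average_mat n * X) $$ (t - 1, c) + (B * Z) $$ (t - 1, c)"
      unfolding private_running_mean_def eq using X B Z t c dims
      by (auto simp del: index_mult_mat(1))
    then show "(private_running_mean B C X Z t - running_mean X t) $ c = row (B * Z) (t - 1) $ c"
      unfolding row using X c avg[OF c] by (simp add: running_mean_def del: index_mult_mat(1))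
  qed (use X Z in \<open>simp add: running_mean_def\<close>)
qed

lemma l2_norm_row_mult:
  assumes "B \<in> carrier_mat m n" "i < m"
  shows "l2_norm (row (B * mat n d z) i) = L2_set (\<lambda>c. \<Sum>j<n. row B i $ j * z (j, c)) {..<d}"
proof -
  have "row (B * mat n d z) i $ c = (\<Sum>j<n. row B i $ j * z (j, c))" if "c < d" for c
    using assms that by (simp add: scalar_prod_def atLeast0LessThan)
  then show ?thesis
    unfolding l2_norm_def by (intro L2_set_cong) simp_all
qed

section \<open>Exponential moments and norm tails of independent Gaussians\<close>

lemma prob_space_gaussian:
  assumes "0 \<le> v"
  shows "prob_space (gaussian m v)"
proof (cases "v = 0")
  case False
  with assms interpret P: prob_space "density lborel (normal_density m (sqrt v))"
    by (intro prob_space_normal_density) auto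
  show ?thesis
    using False P.prob_space_axioms by (simp add: gaussian_def)
qed (simp add: gaussian_def prob_space_return)

lemma sets_gaussian [measurable_cong]: "sets (gaussian m v) = sets borel"
  by (simp add: gaussian_def)

text \<open>The weight cancels half of the exponent \<open>- x\<^sup>2 / (2 * s\<^sup>2)\<close>.
  What remains is a normal density of variance \<open>2 * s\<^sup>2\<close> up to normalisation, and
  the ratio of the two normalising constants is \<open>sqrt 2\<close>.\<close>

lemma nn_integral_normal_density_exp_square:
  assumes "0 < s"
  shows "(\<integral>\<^sup>+x. ennreal (normal_density 0 s x) * ennreal (exp (x\<^sup>2 / (4 * s\<^sup>2))) \<partial>lborel)
    = ennreal (sqrt 2)"
proof -
  have eq: "normal_density 0 s x * exp (x\<^sup>2 / (4 * s\<^sup>2)) = sqrt 2 * normal_density 0 (sqrt 2 * s) x"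
    for x
  proof -
    have "exp (- x\<^sup>2 / (2 * s\<^sup>2)) * exp (x\<^sup>2 / (4 * s\<^sup>2)) = exp (- x\<^sup>2 / (4 * s\<^sup>2))"
      using assms by (subst exp_add[symmetric]) (simp add: field_simps)
    moreover have "sqrt (2 * pi * (sqrt 2 * s)\<^sup>2) = sqrt 2 * sqrt (2 * pi * s\<^sup>2)"
      by (subst real_sqrt_mult[symmetric]) (simp add: power_mult_distrib)
    moreover have "- x\<^sup>2 / (2 * (sqrt 2 * s)\<^sup>2) = - x\<^sup>2 / (4 * s\<^sup>2)"
      by (simp add: power_mult_distrib)
    ultimately show ?thesis
      by (simp only: normal_density_def diff_0_right mult.assoc) simp
  qed
  interpret P: prob_space "density lborel (normal_density 0 (sqrt 2 * s))"
    using assms by (intro prob_space_normal_density) simp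
  have "(\<integral>\<^sup>+x. ennreal (normal_density 0 (sqrt 2 * s) x) \<partial>lborel) = 1"
    using P.emeasure_space_1 by (simp add: emeasure_density)
  moreover have "(\<integral>\<^sup>+x. ennreal (normal_density 0 s x) * ennreal (exp (x\<^sup>2 / (4 * s\<^sup>2))) \<partial>lborel)
      = (\<integral>\<^sup>+x. ennreal (sqrt 2) * ennreal (normal_density 0 (sqrt 2 * s) x) \<partial>lborel)"
    by (intro nn_integral_cong) (simp add: ennreal_mult[symmetric] eq)
  ultimately show ?thesis
    by (simp add: nn_integral_cmult)
qed

lemma (in prob_space) norm_indep_normal_tail:
  assumes fin: "finite L" and ind: "indep_vars (\<lambda>_. borel) G L" and s: "0 < s"
    and G: "\<And>c. c \<in> L \<Longrightarrow> distributed M lborel (G c) (normal_density 0 s)"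
    and \<beta>: "0 < \<beta>" "\<beta> < 1"
  shows "1 - \<beta> \<le> \<P>(z in M. L2_set (\<lambda>c. G c z) L
    \<le> 2 * s * (sqrt (real (card L)) + sqrt (ln (1 / \<beta>))))"
proof -
  define d where "d = real (card L)"
  define r where "r = 2 * s * (sqrt d + sqrt (ln (1 / \<beta>)))"
  \<comment> \<open>This is \<open>exp\<close> of the squared norm over
    \<open>4 * s\<^sup>2\<close>, written as a product of extended nonnegative reals so that
    independence factorises its integral.\<close>
  define u where "u z = (\<Prod>c\<in>L. ennreal (exp ((G c z)\<^sup>2 / (4 * s\<^sup>2))))" for z
  \<comment> \<open>The reciprocal of the Markov threshold: the integral of \<open>u\<close> is
    \<open>sqrt 2 ^ card L\<close>, so \<open>a\<close> times it is exactly
    \<open>\<beta>\<close>.\<close>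
  define a where "a = \<beta> / sqrt 2 ^ card L"
  have a: "0 < a"
    using \<beta> by (simp add: a_def)
  have meas [measurable]: "G c \<in> borel_measurable M" if "c \<in> L" for c
    using ind that by (auto simp: indep_vars_def)
  have u_meas [measurable]: "u \<in> borel_measurable M"
    unfolding u_def by measurable
  have norm_meas [measurable]: "(\<lambda>z. L2_set (\<lambda>c. G c z) L) \<in> borel_measurable M"
    unfolding L2_set_def by measurable
  have ind': "indep_vars (\<lambda>_. borel) (\<lambda>c z. ennreal (exp ((G c z)\<^sup>2 / (4 * s\<^sup>2)))) L"
    by (rule indep_vars_compose2[OF ind]) measurable
  have "(\<integral>\<^sup>+z. u z \<partial>M) = (\<Prod>c\<in>L. \<integral>\<^sup>+z. ennreal (exp ((G c z)\<^sup>2 / (4 * s\<^sup>2))) \<partial>M)"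
    unfolding u_def by (rule indep_vars_nn_integral[OF fin ind']) simp
  also have "\<dots> = (\<Prod>c\<in>L. ennreal (sqrt 2))"
  proof (intro prod.cong refl)
    fix c assume "c \<in> L"
    from distributed_nn_integral[OF G[OF this], of "\<lambda>x. ennreal (exp (x\<^sup>2 / (4 * s\<^sup>2)))"]
    show "(\<integral>\<^sup>+z. ennreal (exp ((G c z)\<^sup>2 / (4 * s\<^sup>2))) \<partial>M) = ennreal (sqrt 2)"
      using nn_integral_normal_density_exp_square[OF s] by simp
  qed
  also have "\<dots> = ennreal (sqrt 2 ^ card L)"
    by (simp add: ennreal_power)
  finally have int: "(\<integral>\<^sup>+z. u z \<partial>M) = ennreal (sqrt 2 ^ card L)" .
  have "emeasure M {z\<in>space M. 1 \<le> ennreal a * u z}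
      \<le> ennreal a * (\<integral>\<^sup>+z. u z * indicator (space M) z \<partial>M)"
    by (rule nn_integral_Markov_inequality) measurable
  also have "(\<integral>\<^sup>+z. u z * indicator (space M) z \<partial>M) = (\<integral>\<^sup>+z. u z \<partial>M)"
    by (intro nn_integral_cong) simp
  also have "ennreal a * (\<integral>\<^sup>+z. u z \<partial>M) = ennreal \<beta>"
    unfolding int using a by (simp add: ennreal_mult[symmetric] a_def)
  finally have Markov: "prob {z\<in>space M. 1 \<le> ennreal a * u z} \<le> \<beta>"
    using \<beta> by (simp add: emeasure_eq_measure)
  \<comment> \<open>What remains is deterministic: a norm above \<open>r\<close> forces
    \<open>u z\<close> to reach the threshold \<open>1 / a\<close>, whose logarithm is
    \<open>d * ln 2 / 2 + ln (1 / \<beta>)\<close>.\<close>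
  have large: "1 \<le> ennreal a * u z" if z: "r < L2_set (\<lambda>c. G c z) L" for z
  proof -
    have ln_nonneg: "0 \<le> ln (1 / \<beta>)"
      using \<beta> by simp
    have d: "0 \<le> d" by (simp add: d_def)
    have "d * ln 2 / 2 + ln (1 / \<beta>) \<le> d + ln (1 / \<beta>)"
      using d ln_2_less_1 mult_left_mono[of "ln 2" "1::real" d] by simp
    \<comment> \<open>Only the nonnegative cross term of the square is added. The factor 2 in
      \<open>r\<close> then cancels the 4 of the exponent.\<close>
    also have "\<dots> \<le> (sqrt d + sqrt (ln (1 / \<beta>)))\<^sup>2"
      using d ln_nonneg by (simp add: power2_sum)
    also have "\<dots> = r\<^sup>2 / (4 * s\<^sup>2)"
      using s by (simp add: r_def power_mult_distrib)
    also have "\<dots> \<le> (L2_set (\<lambda>c. G c z) L)\<^sup>2 / (4 * s\<^sup>2)"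
    proof (intro divide_right_mono power_mono)
      show "0 \<le> r"
        using s d ln_nonneg by (simp add: r_def)
    qed (use z in auto)
    also have "\<dots> = (\<Sum>c\<in>L. (G c z)\<^sup>2 / (4 * s\<^sup>2))"
      by (simp add: L2_set_def sum_nonneg sum_divide_distrib)
    finally have "exp (d * ln 2 / 2 + ln (1 / \<beta>)) \<le> exp (\<Sum>c\<in>L. (G c z)\<^sup>2 / (4 * s\<^sup>2))"
      by simp
    also have "exp (d * ln 2 / 2 + ln (1 / \<beta>)) = 1 / a"
    proof -
      have "exp (d * ln 2 / 2) = exp (real (card L) * ln (sqrt 2))"
        by (simp add: d_def ln_sqrt)
      also have "\<dots> = sqrt 2 ^ card L"
        by (subst exp_of_nat_mult) simp
      finally show ?thesis
        using \<beta> by (simp add: exp_add a_def)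
    qed
    finally have "1 \<le> a * exp (\<Sum>c\<in>L. (G c z)\<^sup>2 / (4 * s\<^sup>2))"
      using a by (simp add: field_simps)
    moreover have "u z = ennreal (exp (\<Sum>c\<in>L. (G c z)\<^sup>2 / (4 * s\<^sup>2)))"
      by (simp add: u_def prod_ennreal exp_sum[OF fin])
    ultimately show ?thesis
      using a by (simp add: ennreal_mult[symmetric])
  qed
  have "prob {z\<in>space M. \<not> L2_set (\<lambda>c. G c z) L \<le> r} \<le> prob {z\<in>space M. 1 \<le> ennreal a * u z}"
    using large by (intro finite_measure_mono) (auto simp: not_le)
  with Markov have "prob {z\<in>space M. \<not> L2_set (\<lambda>c. G c z) L \<le> r} \<le> \<beta>"
    by linarith
  moreover have "prob {z\<in>space M. \<not> L2_set (\<lambda>c. G c z) L \<le> r}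
      = 1 - prob {z\<in>space M. L2_set (\<lambda>c. G c z) L \<le> r}"
    by (rule prob_neg) measurable
  ultimately show ?thesis
    by (simp add: r_def d_def)
qed

section \<open>Weighted sums of independent Gaussians and coordinates of product measures\<close>

lemma (in prob_space) distributed_weighted_sum_normal:
  fixes w :: "'i \<Rightarrow> real"
  assumes fin: "finite J" and ind: "indep_vars (\<lambda>_. borel) Y J" and v: "0 < v"
    and Y: "\<And>j. j \<in> J \<Longrightarrow> distributed M lborel (Y j) (normal_density 0 v)"
    and w: "0 < L2_set w J"
  shows "distributed M lborel (\<lambda>z. \<Sum>j\<in>J. w j * Y j z) (normal_density 0 (v * L2_set w J))"
proof -
  \<comment> \<open>A term of weight 0 is constant and has no normal density, so such terms are
    dropped before the variances are added. The positive norm of \<open>w\<close> ensures that some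
    term survives.\<close>
  define J' where "J' = {j\<in>J. w j \<noteq> 0}"
  have J': "finite J'" "J' \<subseteq> J"
    using fin by (auto simp: J'_def)
  have "J' \<noteq> {}"
  proof
    assume "J' = {}"
    then have "L2_set w J = 0"
      unfolding J'_def using fin by (subst L2_set_eq_0_iff) blast+
    with w show False by simp
  qed
  moreover have "indep_vars (\<lambda>_. borel) (\<lambda>j z. w j * Y j z) J'"
    by (rule indep_vars_compose2[OF indep_vars_subset[OF ind J'(2)]]) measurable
  moreover have "distributed M lborel (\<lambda>z. w j * Y j z) (normal_density 0 (\<bar>w j\<bar> * v))"
    if "j \<in> J'" for j
    using normal_density_affine[OF Y v, of j "w j" 0] that by (auto simp: J'_def)
  ultimately have "distributed M lborel (\<lambda>z. \<Sum>j\<in>J'. w j * Y j z)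
      (normal_density (\<Sum>j\<in>J'. 0) (sqrt (\<Sum>j\<in>J'. (\<bar>w j\<bar> * v)\<^sup>2)))"
    using v J' by (intro sum_indep_normal) (auto simp: J'_def)
  moreover have "(\<Sum>j\<in>J'. w j * Y j z) = (\<Sum>j\<in>J. w j * Y j z)" for z
    using fin by (intro sum.mono_neutral_left) (auto simp: J'_def)
  moreover have "sqrt (\<Sum>j\<in>J'. (\<bar>w j\<bar> * v)\<^sup>2) = v * L2_set w J"
  proof -
    have "(\<Sum>j\<in>J'. (\<bar>w j\<bar> * v)\<^sup>2) = (\<Sum>j\<in>J. (\<bar>w j\<bar> * v)\<^sup>2)"
      using fin by (intro sum.mono_neutral_left) (auto simp: J'_def)
    also have "\<dots> = v\<^sup>2 * (\<Sum>j\<in>J. (w j)\<^sup>2)"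
      by (simp add: power_mult_distrib sum_distrib_left mult.commute)
    finally show ?thesis
      using v by (simp add: L2_set_def real_sqrt_mult)
  qed
  ultimately show ?thesis
    by simp
qed

text \<open>Independence amounts to the joint law being the product of the marginals. Here the joint
  law of the coordinates is the product measure itself.\<close>

lemma indep_vars_PiM_component:
  assumes N: "\<And>i. i \<in> I \<Longrightarrow> prob_space (N i)" and I: "I \<noteq> {}"
  shows "prob_space.indep_vars (PiM I N) N (\<lambda>i z. z i) I"
proof -
  interpret prob_space "PiM I N"
    using N by (rule prob_space_PiM)
  \<comment> \<open>Points of the product space are already extensional on \<open>I\<close>, so the
    restriction acts as the identity.\<close>
  have "distr (PiM I N) (PiM I N) (\<lambda>z. \<lambda>i\<in>I. z i) = distr (PiM I N) (PiM I N) (\<lambda>z. z)"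
    by (intro distr_cong) (auto simp: space_PiM)
  also have "\<dots> = PiM I (\<lambda>i. distr (PiM I N) (N i) (\<lambda>z. z i))"
    using N by (auto simp: distr_PiM_component intro!: PiM_cong)
  finally show ?thesis
    using I by (subst indep_vars_iff_distr_eq_PiM') auto
qed

section \<open>The tail of one row of the transformed noise\<close>

text \<open>Each column yields one normal variable of standard deviation \<open>s\<close>, and
  distinct columns use disjoint noise entries, so the tail bound for independent normals applies.
  Degenerate parameters, where these densities do not exist, are handled separately.\<close>

lemma gaussian_noise_weighted_sum_tail:
  fixes w :: "nat \<Rightarrow> real"
  assumes v: "0 \<le> v" and \<beta>: "0 < \<beta>" "\<beta> < 1"
  shows "1 - \<beta> \<le> \<P>(z in gaussian_noise n d v. L2_set (\<lambda>c. \<Sum>j<n. w j * z (j, c)) {..<d}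
    \<le> 2 * (sqrt v * L2_set w {..<n} * (sqrt (real d) + sqrt (ln (1 / \<beta>)))))"
proof -
  define I where "I = {..<n} \<times> {..<d}"
  define M where "M = (\<Pi>\<^sub>M ij\<in>I. gaussian 0 v)"
  define s where "s = sqrt v * L2_set w {..<n}"
  have M: "gaussian_noise n d v = M"
    by (simp add: gaussian_noise_def M_def I_def)
  interpret prob_space M
    unfolding M_def using v by (intro prob_space_PiM prob_space_gaussian)
  have coord [measurable]: "(\<lambda>z. z (j, c)) \<in> borel_measurable M" if "j < n" "c < d" for j c
  proof -
    have "(\<lambda>z. z (j, c)) \<in> measurable M (gaussian 0 v)"
      unfolding M_def using that by (intro measurable_component_singleton) (simp add: I_def)
    then show ?thesis
      by (simp add: measurable_cong_sets[OF refl sets_gaussian])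
  qed
  show ?thesis
  proof (cases "I = {} \<or> s = 0")
    \<comment> \<open>There are no entries, the noise is a point mass, or the weights vanish. In
      each case the norm is almost surely 0.\<close>
    case True
    have "AE z in M. z i = 0" if "v = 0" "i \<in> I" for i
    proof -
      have "gaussian 0 v = return borel 0"
        using that by (simp add: gaussian_def)
      moreover have "AE x in return borel 0. x = (0 :: real)"
        by (subst AE_return) auto
      ultimately have "AE x in gaussian 0 v. x = 0"
        by (simp only:)
      then show ?thesis
        unfolding M_def by (rule AE_PiM_component[OF prob_space_gaussian[OF v] that(2)])
    qed
    \<comment> \<open>Keeping \<open>v = 0\<close> as a premise inside the almost-sure statement
      lets one argument cover vanishing noise and vanishing weights.\<close>
    then have zero: "AE z in M. v = 0 \<longrightarrow> z i = 0" if "i \<in> I" for i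
      using that by (cases "v = 0") simp_all
    have "finite I"
      by (simp add: I_def)
    with zero have "AE z in M. \<forall>i\<in>I. v = 0 \<longrightarrow> z i = 0"
      by (intro AE_finite_allI)
    then have "AE z in M. L2_set (\<lambda>c. \<Sum>j<n. w j * z (j, c)) {..<d} = 0"
    proof eventually_elim
      case (elim z)
      have "w j * z (j, c) = 0" if "j < n" "c < d" for j c
      proof (cases "v = 0")
        case True
        then show ?thesis
          using elim that by (auto simp: I_def)
      next
        case False
        \<comment> \<open>The pair \<open>(j, c)\<close> lies in \<open>I\<close>, so the case
          assumption leaves \<open>s = 0\<close>, and with \<open>v\<close> nonzero the weights must
          vanish.\<close>
        then have "L2_set w {..<n} = 0"
          using \<open>I = {} \<or> s = 0\<close> that by (auto simp: I_def s_def)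
        then show ?thesis
          using that by (simp add: L2_set_eq_0_iff)
      qed
      then have "(\<Sum>j<n. w j * z (j, c)) = 0" if "c < d" for c
        using that by (intro sum.neutral) blast
      then show ?case
        by (simp add: L2_set_def)
    qed
    moreover have "0 \<le> 2 * (s * (sqrt (real d) + sqrt (ln (1 / \<beta>))))"
      unfolding s_def using v \<beta>
      by (intro mult_nonneg_nonneg add_nonneg_nonneg L2_set_nonneg) simp_all
    ultimately have "AE z in M. L2_set (\<lambda>c. \<Sum>j<n. w j * z (j, c)) {..<d}
        \<le> 2 * (s * (sqrt (real d) + sqrt (ln (1 / \<beta>))))"
      by auto
    moreover have "(\<lambda>z. L2_set (\<lambda>c. \<Sum>j<n. w j * z (j, c)) {..<d}) \<in> borel_measurable M"
      unfolding L2_set_def by measurable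
    ultimately have "\<P>(z in M. L2_set (\<lambda>c. \<Sum>j<n. w j * z (j, c)) {..<d}
        \<le> 2 * (s * (sqrt (real d) + sqrt (ln (1 / \<beta>))))) = 1"
      by (subst prob_Collect_eq_1) auto
    then show ?thesis
      using \<beta> by (simp add: M s_def)
  next
    case False
    then have I: "I \<noteq> {}" and s: "0 < s"
      using v by (auto simp: s_def less_le)
    then have v0: "0 < sqrt v" and w0: "0 < L2_set w {..<n}"
      using v by (auto simp: s_def less_le)
    have "indep_vars (\<lambda>_. gaussian 0 v) (\<lambda>i z. z i) I"
      unfolding M_def using v I by (intro indep_vars_PiM_component prob_space_gaussian)
    then have ind: "indep_vars (\<lambda>_. borel) (\<lambda>i z. z i) I"
      by (rule indep_vars_compose2[where Y = "\<lambda>_ x. x"])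
        (rule measurable_ident_sets[OF sets_gaussian])
    have normal: "distributed M lborel (\<lambda>z. z i) (normal_density 0 (sqrt v))" if "i \<in> I" for i
    proof -
      have "distr M lborel (\<lambda>z. z i) = distr M (gaussian 0 v) (\<lambda>z. z i)"
        by (rule distr_cong) (simp_all add: sets_gaussian)
      also have "\<dots> = gaussian 0 v"
        unfolding M_def by (rule distr_PiM_component[OF prob_space_gaussian[OF v] that])
      also have "\<dots> = density lborel (normal_density 0 (sqrt v))"
        using v0 by (simp add: gaussian_def)
      finally have "distr M lborel (\<lambda>z. z i) = density lborel (normal_density 0 (sqrt v))" .
      moreover have "(\<lambda>z. z i) \<in> borel_measurable M"
        using coord that by (auto simp: I_def)
      ultimately show ?thesis
        by (simp add: distributed_def)
    qed
    \<comment> \<open>Independence is grouped into columns: the index blocks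
      \<open>{..<n} \<times> {c}\<close> are pairwise disjoint, and each sum is a measurable
      function of its own block.\<close>
    have "indep_vars (\<lambda>c. \<Pi>\<^sub>M i\<in>{..<n} \<times> {c}. borel)
        (\<lambda>c z. restrict (\<lambda>i. z i) ({..<n} \<times> {c})) {..<d}"
      by (rule indep_vars_restrict[OF ind]) (auto simp: I_def disjoint_family_on_def)
    then have "indep_vars (\<lambda>_. borel)
        (\<lambda>c z. (\<lambda>y. \<Sum>j<n. w j * y (j, c)) (restrict (\<lambda>i. z i) ({..<n} \<times> {c}))) {..<d}"
      by (rule indep_vars_compose2[where Y = "\<lambda>c y. \<Sum>j<n. w j * y (j, c)"]) measurable
    then have ind_cols: "indep_vars (\<lambda>_. borel) (\<lambda>c z. \<Sum>j<n. w j * z (j, c)) {..<d}"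
      by simp
    have "distributed M lborel (\<lambda>z. \<Sum>j<n. w j * z (j, c)) (normal_density 0 s)" if "c < d" for c
    proof -
      \<comment> \<open>The summand \<open>h\<close> receives both the row index and the full index,
        so the same reindexing serves the weights and the weighted noise.\<close>
      have sum_col: "(\<Sum>i\<in>{..<n} \<times> {c}. h (fst i) i) = (\<Sum>j<n. h j (j, c))"
        for h :: "nat \<Rightarrow> nat \<times> nat \<Rightarrow> real"
        by (rule sum.reindex_bij_witness[of _ "\<lambda>j. (j, c)" fst]) auto
      have L2: "L2_set (\<lambda>i. w (fst i)) ({..<n} \<times> {c}) = L2_set w {..<n}"
        using sum_col[of "\<lambda>j _. (w j)\<^sup>2"] by (simp add: L2_set_def)
      have "distributed M lborel (\<lambda>z. \<Sum>i\<in>{..<n} \<times> {c}. w (fst i) * z i)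
          (normal_density 0 (sqrt v * L2_set (\<lambda>i. w (fst i)) ({..<n} \<times> {c})))"
      proof (rule distributed_weighted_sum_normal)
        show "indep_vars (\<lambda>_. borel) (\<lambda>i z. z i) ({..<n} \<times> {c})"
          using that by (intro indep_vars_subset[OF ind]) (auto simp: I_def)
      qed (use that normal v0 w0 L2 in \<open>auto simp: I_def\<close>)
      moreover have "(\<Sum>i\<in>{..<n} \<times> {c}. w (fst i) * z i) = (\<Sum>j<n. w j * z (j, c))" for z
        by (rule sum_col[of "\<lambda>j i. w j * z i"])
      ultimately show ?thesis
        by (simp add: L2 s_def)
    qed
    then show ?thesis
      using norm_indep_normal_tail[OF _ ind_cols s _ \<beta>] by (simp add: M s_def mult.assoc)
  qed
qed

section \<open>The error bound with an absolute constant\<close>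

theorem theorem4:
  "\<exists>K::real. K > 0 \<and>
    (\<forall>(n::nat) (d::nat) (k::nat) (b::nat) (X::real mat) (B::real mat) (C::real mat)
       (\<zeta>::real) (\<sigma>::real) (t::nat) (\<beta>::real).
      X \<in> carrier_mat n d \<longrightarrow>
      (\<forall>i<n. linf_norm (row X i) \<le> \<zeta>) \<longrightarrow>
      B \<in> carrier_mat n n \<longrightarrow>
      C \<in> carrier_mat n n \<longrightarrow>
      running_average_mat n = B * C \<longrightarrow>
      \<sigma> > 0 \<longrightarrow>
      t \<in> {1..n} \<longrightarrow>
      0 < \<beta> \<longrightarrow> \<beta> < 1 \<longrightarrow>
      \<P>(z in mechanism_noise n d k b C \<zeta> \<sigma>.
          l2_norm (private_running_mean B C X (mat n d z) t - running_mean X t)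
            \<le> K * (sqrt (real d * \<zeta>\<^sup>2) * \<sigma> * sens d k b C * l2_norm (row B (t - 1))
                   * (sqrt (real d) + sqrt (ln (1 / \<beta>))))) \<ge> 1 - \<beta>)"
\<comment> \<open>The witness is the factor 2 of \<open>gaussian_noise_weighted_sum_tail\<close>,
  fixed before any parameter is introduced.\<close>
proof (rule exI[of _ 2], intro conjI allI impI)
  fix n d k b :: nat and X B C :: "real mat" and \<zeta> \<sigma> :: real and t :: nat and \<beta> :: real
  assume X: "X \<in> carrier_mat n d" and B: "B \<in> carrier_mat n n" and C: "C \<in> carrier_mat n n"
    and A: "running_average_mat n = B * C" and \<sigma>: "0 < \<sigma>" and t: "t \<in> {1..n}"
    and \<beta>: "0 < \<beta>" "\<beta> < 1"
  define v where "v = \<sigma>\<^sup>2 * (sqrt (real d * \<zeta>\<^sup>2))\<^sup>2 * (sens d k b C)\<^sup>2"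
  define w where "w = (\<lambda>j. row B (t - 1) $ j)"
  have noise: "mechanism_noise n d k b C \<zeta> \<sigma> = gaussian_noise n d v"
    by (simp add: mechanism_noise_def v_def Let_def)
  have error: "l2_norm (private_running_mean B C X (mat n d z) t - running_mean X t)
      = L2_set (\<lambda>c. \<Sum>j<n. w j * z (j, c)) {..<d}" for z
  proof -
    have "private_running_mean B C X (mat n d z) t - running_mean X t
        = row (B * mat n d z) (t - 1)"
      using X B C A t by (intro mf_mechanism_error) auto
    moreover have "t - 1 < n"
      using t by auto
    ultimately show ?thesis
      using l2_norm_row_mult[OF B] by (simp add: w_def)
  qed
  \<comment> \<open>The root of a product of squares is a product of absolute values; the signs of
    \<open>\<sigma>\<close> and of the sensitivity remove them.\<close>
  have sd: "sqrt v = sqrt (real d * \<zeta>\<^sup>2) * \<sigma> * sens d k b C"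
    using \<sigma> sens_nonneg[of d k b C] by (simp add: v_def real_sqrt_mult)
  have norm: "l2_norm (row B (t - 1)) = L2_set w {..<n}"
    using B by (simp add: l2_norm_def w_def)
  have "0 \<le> v"
    by (simp add: v_def)
  then show "1 - \<beta> \<le> \<P>(z in mechanism_noise n d k b C \<zeta> \<sigma>.
      l2_norm (private_running_mean B C X (mat n d z) t - running_mean X t)
        \<le> 2 * (sqrt (real d * \<zeta>\<^sup>2) * \<sigma> * sens d k b C * l2_norm (row B (t - 1))
               * (sqrt (real d) + sqrt (ln (1 / \<beta>)))))"
    unfolding noise error norm sd[symmetric] using \<beta> by (rule gaussian_noise_weighted_sum_tail)
qed simp

end
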